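(* Let $n\ge 1$ and $0\le k\le n-1$. Let $\mathcal{P}(n+k-1,k)$ be the set of partial matchings of $[n+k-1]$ with exactly $k$ arcs that contain no $2$-right crossings and no right nestings, and let $\mathcal{CT}(n,k)$ be the set of set partitions of $[n]$ with exactly $k$ arcs that contain no right crossings. Then there is a bijection from $\mathcal{P}(n+k-1,k)$ to $\mathcal{CT}(n,k)$ which transforms the number of neighbor alignments of a partial matching into the number of transients of a partition; that is, for every $M\in\mathcal{P}(n+k-1,k)$, the number of neighbor alignments of $M$ equals the number of transients of its image.
   Context: $[m]=\{1,2,\ldots,m\}$, with $[0]=\emptyset$ (which has exactly one partition, the empty one). The arcs of a set partition $\pi$ of $[m]$ are those of its linear representation: for each block $\{i_1<i_2<\cdots<i_r\}$ of $\pi$, the arcs are the pairs $(i_1,i_2),(i_2,i_3),\ldots,(i_{r-1},i_r)$ (a singleton block gives no arc). A partial matching is a set partition in which every block has at most two elements. For a set partition (in particular a partial matching), with all arcs below belonging to it: - a right nesting is a pair of arcs $(i_1,j_1)$, $(i_2,j_2)$ with $i_1<i_2<j_2<j_1$ and $j_1=j_2+1$; - a right crossing is a pair of arcs $(i_1,j_1)$, $(i_2,j_2)$ with $i_1<i_2<j_1<j_2$ and $j_2=j_1+1$; - a $2$-right crossing is a pair of arcs $(i_1,j_1)$, $(i_2,j_2)$ with $i_1<i_2<j_1<j_2$ and $j_2-j_1\le 2$; - a neighbor alignment is a pair of arcs $(i_1,j_1)$, $(i_2,j_2)$ with $i_2=j_1+1$; - a transient is a vertex $j$ for which there are arcs $(i,j)$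 and $(j,k)$ with $i<j<k$. *)

theory Defs
  imports Main "HOL-Library.Disjoint_Sets"
begin

text \<open>A set partition of $[m]$ is a set of blocks \<open>P\<close> with \<^term>\<open>partition_on {1..m} P\<close>;
  for \<open>m = 0\<close> the interval is empty and \<^term>\<open>{}\<close> is its only partition.\<close>

definition arcs :: "nat set set \<Rightarrow> (nat \<times> nat) set" where
  "arcs P = {(i, j). \<exists>B\<in>P. i \<in> B \<and> j \<in> B \<and> i < j \<and> (\<forall>x\<in>B. \<not> (i < x \<and> x < j))}"

definition partial_matching :: "nat \<Rightarrow> nat set set \<Rightarrow> bool" where
  "partial_matching m P \<longleftrightarrow> partition_on {1..m} P \<and> (\<forall>B\<in>P. card B \<le> 2)"

definition right_nesting :: "nat \<times> nat \<Rightarrow> nat \<times> nat \<Rightarrow> bool" where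
  "right_nesting = (\<lambda>(i1, j1) (i2, j2). i1 < i2 \<and> i2 < j2 \<and> j2 < j1 \<and> j1 = j2 + 1)"

definition right_crossing :: "nat \<times> nat \<Rightarrow> nat \<times> nat \<Rightarrow> bool" where
  "right_crossing = (\<lambda>(i1, j1) (i2, j2). i1 < i2 \<and> i2 < j1 \<and> j1 < j2 \<and> j2 = j1 + 1)"

text \<open>The subtraction on natural numbers does not truncate here, because \<open>j1 < j2\<close>.\<close>

definition two_right_crossing :: "nat \<times> nat \<Rightarrow> nat \<times> nat \<Rightarrow> bool" where
  "two_right_crossing = (\<lambda>(i1, j1) (i2, j2). i1 < i2 \<and> i2 < j1 \<and> j1 < j2 \<and> j2 - j1 \<le> 2)"

definition neighbor_alignment :: "nat \<times> nat \<Rightarrow> nat \<times> nat \<Rightarrow> bool" where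
  "neighbor_alignment = (\<lambda>(i1, j1) (i2, j2). i2 = j1 + 1)"

definition neighbor_alignments :: "nat set set \<Rightarrow> ((nat \<times> nat) \<times> (nat \<times> nat)) set" where
  "neighbor_alignments P = {(a, b). a \<in> arcs P \<and> b \<in> arcs P \<and> neighbor_alignment a b}"

definition transients :: "nat set set \<Rightarrow> nat set" where
  "transients P = {j. \<exists>i k. (i, j) \<in> arcs P \<and> (j, k) \<in> arcs P \<and> i < j \<and> j < k}"

definition matchings_P :: "nat \<Rightarrow> nat \<Rightarrow> nat set set set" where
  "matchings_P m k = {M. partial_matching m M \<and> card (arcs M) = k \<and>
     (\<forall>a\<in>arcs M. \<forall>b\<in>arcs M. \<not> two_right_crossing a b \<and> \<not> right_nesting a b)}"

definition partitions_CT :: "nat \<Rightarrow> nat \<Rightarrow> nat set set set" where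
  "partitions_CT n k = {P. partition_on {1..n} P \<and> card (arcs P) = k \<and>
     (\<forall>a\<in>arcs P. \<forall>b\<in>arcs P. \<not> right_crossing a b)}"

end

theory Submission
  imports Defs
begin

text \<open>A set partition is encoded by its arcs. In a matching without right nestings and 2-right
  crossings no two closers are adjacent, so, after appending one empty vertex at the right end, every
  closer can be merged with the non-closer that follows it. This turns \<open>n + k\<close> vertices
  into \<open>n\<close>; a merged vertex is a transient exactly when the absorbed vertex was an opener, and
  closers at distance two become adjacent closers, so 2-right crossings become right crossings.
  Conversely, every closer of a partition is split into a closer followed by a vertex that
  inherits the outgoing arc, if any.\<close>

section \<open>Set partitions as arc diagrams\<close>

text \<open>Every vertex opens at most one arc and closes at most one, so the components are
  increasing paths. By \<open>bij_betw_arcs\<close> these are exactly the arc sets of set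
  partitions.\<close>

definition arc_diagram :: "nat \<Rightarrow> (nat \<times> nat) set \<Rightarrow> bool" where
  "arc_diagram m A \<longleftrightarrow> (\<forall>(i, j)\<in>A. 1 \<le> i \<and> i < j \<and> j \<le> m) \<and> single_valued A \<and> single_valued (A\<inverse>)"

text \<open>Components are directed paths, so two vertices are connected iff one reaches the other.
  Reflexivity on \<open>{1..m}\<close> turns vertices without arcs into singleton blocks.\<close>

definition connection :: "nat \<Rightarrow> (nat \<times> nat) set \<Rightarrow> (nat \<times> nat) set" where
  "connection m A = {(x, y). x \<in> {1..m} \<and> y \<in> {1..m} \<and> ((x, y) \<in> A\<^sup>* \<or> (y, x) \<in> A\<^sup>*)}"

lemma arc_diagramD:
  assumes "arc_diagram m A" "(i, j) \<in> A"
  shows "1 \<le> i" "i < j" "j \<le> m"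
  using assms by (auto simp: arc_diagram_def)

lemma arc_diagram_same_opener:
  assumes "arc_diagram m A" "(i, j) \<in> A" "(i, j') \<in> A"
  shows "j = j'"
  using assms by (auto simp: arc_diagram_def dest: single_valuedD)

lemma arc_diagram_same_closer:
  assumes "arc_diagram m A" "(i, j) \<in> A" "(i', j) \<in> A"
  shows "i = i'"
  using assms by (auto simp: arc_diagram_def dest: single_valuedD)

lemma arc_diagram_finite:
  assumes "arc_diagram m A"
  shows "finite A"
proof (rule finite_subset)
  show "A \<subseteq> {0..m} \<times> {0..m}"
    using arc_diagramD[OF assms] by fastforce
qed auto

lemma arc_diagram_card_Range:
  assumes "arc_diagram m A"
  shows "card (Range A) = card A"
proof -
  have "inj_on snd A"
    using arc_diagram_same_closer[OF assms] by (auto simp: inj_on_def)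
  then show ?thesis
    by (simp add: Range_snd card_image)
qed

lemma arc_diagram_rtrancl_le:
  assumes "arc_diagram m A" "(x, y) \<in> A\<^sup>*"
  shows "x \<le> y"
  using assms(2) by induction (use arc_diagramD[OF assms(1)] in fastforce)+

text \<open>Only transitivity needs an argument: single-valuedness makes two paths out of a common
  vertex comparable, and single-valuedness of the converse does the same for two paths into a common
  vertex.\<close>

lemma equiv_connection:
  assumes A: "arc_diagram m A"
  shows "equiv {1..m} (connection m A)"
proof -
  have sv: "single_valued A" "single_valued (A\<inverse>)"
    using A by (auto simp: arc_diagram_def)
  have right: "(y, z) \<in> A\<^sup>* \<or> (z, y) \<in> A\<^sup>*" if "(x, y) \<in> A\<^sup>*" "(x, z) \<in> A\<^sup>*" for x y z
    using single_valued_confluent[OF sv(1) that] .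
  have left: "(x, y) \<in> A\<^sup>* \<or> (y, x) \<in> A\<^sup>*" if "(x, z) \<in> A\<^sup>*" "(y, z) \<in> A\<^sup>*" for x y z
    using single_valued_confluent[OF sv(2), of z x y] that by (auto simp: rtrancl_converse)
  have "trans (connection m A)"
    unfolding trans_def connection_def
    by (auto intro: rtrancl_trans dest: right left)
  then show ?thesis
    by (auto simp: equiv_def refl_on_def sym_def connection_def)
qed

text \<open>Induction on the distance: an element of the block strictly between \<open>x\<close> and
  \<open>y\<close> splits the path, and without one \<open>(x, y)\<close> is itself an arc.\<close>

lemma same_block_rtrancl:
  assumes "B \<in> P" "x \<in> B" "y \<in> B" "x \<le> y"
  shows "(x, y) \<in> (arcs P)\<^sup>*"
  using assms(2-)
proof (induction "y - x" arbitrary: x y rule: less_induct)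
  case less
  show ?case
  proof (cases "\<exists>z\<in>B. x < z \<and> z < y")
    case True
    then obtain z where "z \<in> B" "x < z" "z < y"
      by blast
    with less have "(x, z) \<in> (arcs P)\<^sup>*" "(z, y) \<in> (arcs P)\<^sup>*"
      by auto
    then show ?thesis
      by (rule rtrancl_trans)
  next
    case False
    then have "(x, y) \<in> arcs P" if "x < y"
      using less.prems that assms(1) by (auto simp: arcs_def)
    then show ?thesis
      using less.prems(3) by (cases "x = y") auto
  qed
qed

lemma arcs_same_block:
  assumes "partition_on S P" "B \<in> P" "(x, y) \<in> arcs P"
  shows "x \<in> B \<longleftrightarrow> y \<in> B"
  using assms unfolding arcs_def by (auto dest: partition_onD2 disjointD)

lemma rtrancl_arcs_same_block:
  assumes "partition_on S P" "B \<in> P" "(x, y) \<in> (arcs P)\<^sup>*"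
  shows "x \<in> B \<longleftrightarrow> y \<in> B"
  using assms(3) by induction (use arcs_same_block[OF assms(1,2)] in auto)

text \<open>Two arcs sharing an opener or a closer lie in the same block; were they different, the
  longer one would jump over an end of the shorter.\<close>

lemma arc_diagram_arcs:
  assumes P: "partition_on {1..m} P"
  shows "arc_diagram m (arcs P)"
  unfolding arc_diagram_def
proof (intro conjI)
  show "\<forall>(i, j)\<in>arcs P. 1 \<le> i \<and> i < j \<and> j \<le> m"
    using partition_onD1[OF P] unfolding arcs_def by auto
  have between: "\<not> (i < x \<and> x < j)" if ij: "(i, j) \<in> arcs P" and x: "(i, x) \<in> arcs P \<or> (x, j) \<in> arcs P" for i j x
  proof -
    obtain B where "B \<in> P" "i \<in> B" "j \<in> B" "\<forall>x\<in>B. \<not> (i < x \<and> x < j)"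
      using ij unfolding arcs_def by auto
    moreover from this x have "x \<in> B"
      using arcs_same_block[OF P] by blast
    ultimately show ?thesis
      by blast
  qed
  have lt: "i < j" if "(i, j) \<in> arcs P" for i j
    using that by (auto simp: arcs_def)
  show "single_valued (arcs P)"
    unfolding single_valued_def by (meson between lt linorder_neqE_nat)
  show "single_valued ((arcs P)\<inverse>)"
    unfolding single_valued_def converse_iff by (meson between lt linorder_neqE_nat)
qed

text \<open>Arcs never leave a block and chain together all of its elements, so the blocks are the
  components of the diagram.\<close>

lemma partition_eq_quotient_connection:
  assumes P: "partition_on {1..m} P"
  shows "P = {1..m} // connection m (arcs P)"
proof -
  have "connection m (arcs P) = {(x, y). \<exists>B\<in>P. x \<in> B \<and> y \<in> B}"
  proof (intro equalityI subrelI)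
    fix x y
    assume "(x, y) \<in> connection m (arcs P)"
    then have x: "x \<in> \<Union>P" and xy: "(x, y) \<in> (arcs P)\<^sup>* \<or> (y, x) \<in> (arcs P)\<^sup>*"
      using partition_onD1[OF P] by (auto simp: connection_def)
    from x obtain B where "B \<in> P" "x \<in> B"
      by blast
    with xy show "(x, y) \<in> {(x, y). \<exists>B\<in>P. x \<in> B \<and> y \<in> B}"
      using rtrancl_arcs_same_block[OF P] by blast
  next
    fix x y
    assume "(x, y) \<in> {(x, y). \<exists>B\<in>P. x \<in> B \<and> y \<in> B}"
    then obtain B where "B \<in> P" "x \<in> B" "y \<in> B"
      by blast
    then show "(x, y) \<in> connection m (arcs P)"
      using partition_onD1[OF P] same_block_rtrancl[of B P x y] same_block_rtrancl[of B P y x]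
      unfolding connection_def by (cases "x \<le> y") auto
  qed
  then show ?thesis
    using partition_on_eq_quotient[OF P] by simp
qed

text \<open>Every path leaving \<open>i\<close> starts with the unique arc at \<open>i\<close> and
  increases, so the next larger vertex in the class of \<open>i\<close> is the end of that
  arc.\<close>

lemma arcs_quotient_connection:
  assumes A: "arc_diagram m A"
  shows "arcs ({1..m} // connection m A) = A"
proof -
  let ?E = "connection m A"
  note eq = equiv_connection[OF A]
  have block: "(\<exists>B\<in>{1..m} // ?E. i \<in> B \<and> j \<in> B \<and> i < j \<and> (\<forall>x\<in>B. \<not> (i < x \<and> x < j))) \<longleftrightarrow>
      (i, j) \<in> ?E \<and> i < j \<and> (\<forall>x. (i, x) \<in> ?E \<longrightarrow> \<not> (i < x \<and> x < j))" (is "?L \<longleftrightarrow> ?R") for i j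
  proof
    assume ?L
    then obtain B where B: "B \<in> {1..m} // ?E" "i \<in> B" "j \<in> B" "i < j" "\<forall>x\<in>B. \<not> (i < x \<and> x < j)"
      by blast
    then have "B = ?E `` {i}"
      using eq by (metis quotientE equiv_class_eq_iff Image_singleton_iff)
    with B show ?R
      by auto
  next
    assume ?R
    moreover from this have "i \<in> {1..m}"
      by (auto simp: connection_def)
    ultimately have "i \<in> ?E `` {i}" "j \<in> ?E `` {i}" "?E `` {i} \<in> {1..m} // ?E"
      using equiv_class_self[OF eq] quotientI by fast+
    with \<open>?R\<close> show ?L
      by blast
  qed
  \<comment> \<open>Paths increase, so connection to a larger vertex means a nonempty path starting
    at \<open>i\<close>.\<close>
  have up: "\<exists>z. (i, z) \<in> A \<and> (z, x) \<in> A\<^sup>*" if "(i, x) \<in> ?E" "i < x" for i x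
  proof -
    have "(i, x) \<in> A\<^sup>*"
      using that arc_diagram_rtrancl_le[OF A, of x i] by (auto simp: connection_def)
    with that show ?thesis
      by (auto elim: converse_rtranclE)
  qed
  have "(i, j) \<in> ?E \<and> i < j \<and> (\<forall>x. (i, x) \<in> ?E \<longrightarrow> \<not> (i < x \<and> x < j)) \<longleftrightarrow> (i, j) \<in> A"
    (is "?L \<longleftrightarrow> ?R") for i j
  proof
    assume L: ?L
    then obtain z where z: "(i, z) \<in> A" "(z, j) \<in> A\<^sup>*"
      using up by blast
    have "z \<le> j"
      using z arc_diagram_rtrancl_le[OF A] by blast
    moreover have "(i, z) \<in> ?E"
      using z arc_diagramD[OF A z(1)] by (auto simp: connection_def)
    ultimately have "z = j"
      using L arc_diagramD[OF A z(1)] by force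
    with z show ?R
      by simp
  next
    assume R: ?R
    note ij = arc_diagramD[OF A R]
    have "(i, j) \<in> ?E"
      using R ij by (auto simp: connection_def)
    moreover have "j \<le> x" if "(i, x) \<in> ?E" "i < x" for x
      using up[OF that] R arc_diagram_same_opener[OF A] arc_diagram_rtrancl_le[OF A] by blast
    ultimately show ?L
      using ij by force
  qed
  then show ?thesis
    unfolding arcs_def block by auto
qed

lemma bij_betw_arcs:
  "bij_betw arcs {P. partition_on {1..m} P} {A. arc_diagram m A}"
proof (rule bij_betw_byWitness[where f' = "\<lambda>A. {1..m} // connection m A"])
  show "\<forall>P\<in>{P. partition_on {1..m} P}. {1..m} // connection m (arcs P) = P"
    using partition_eq_quotient_connection by auto
  show "(\<lambda>A. {1..m} // connection m A) ` {A. arc_diagram m A} \<subseteq> {P. partition_on {1..m} P}"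
    using equiv_connection partition_on_quotient by blast
qed (auto simp: arcs_quotient_connection arc_diagram_arcs simp del: One_nat_def)

text \<open>A middle element of a block with three elements both closes an arc and opens one;
  conversely, consecutive arcs force three elements into one block.\<close>

lemma partial_matching_iff_arcs:
  assumes P: "partition_on {1..m} P"
  shows "partial_matching m P \<longleftrightarrow> Domain (arcs P) \<inter> Range (arcs P) = {}"
proof
  assume M: "partial_matching m P"
  show "Domain (arcs P) \<inter> Range (arcs P) = {}"
  proof (rule ccontr)
    assume "Domain (arcs P) \<inter> Range (arcs P) \<noteq> {}"
    then obtain i j l where arcs: "(i, j) \<in> arcs P" "(j, l) \<in> arcs P"
      by blast
    then obtain B where B: "B \<in> P" "i \<in> B" "j \<in> B"
      unfolding arcs_def by blast
    with arcs have "l \<in> B"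
      using arcs_same_block[OF P] by blast
    moreover have "i < j" "j < l"
      using arcs by (auto simp: arcs_def)
    moreover have "finite B"
      using B(1) P by (metis finite_atLeastAtMost finite_subset partition_onD1 Union_upper)
    ultimately have "card {i, j, l} \<le> card B"
      using B by (intro card_mono) auto
    with \<open>i < j\<close> \<open>j < l\<close> M B show False
      by (auto simp: partial_matching_def)
  qed
next
  assume D: "Domain (arcs P) \<inter> Range (arcs P) = {}"
  have "card B \<le> 2" if B: "B \<in> P" for B
  proof (rule ccontr)
    assume "\<not> card B \<le> 2"
    then obtain a b c where "{a, b, c} \<subseteq> B" "a \<noteq> b" "b \<noteq> c" "a \<noteq> c"
      using card_3_iff obtain_subset_with_card_n[of 3 B] by (metis not_less_eq_eq numeral_2_eq_2 numeral_3_eq_3)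
    then obtain x y z where "x \<in> B" "y \<in> B" "z \<in> B" "x < y" "y < z"
      by (metis insert_subset linorder_neqE_nat)
    then have "(x, y) \<in> (arcs P)\<^sup>+" "(y, z) \<in> (arcs P)\<^sup>+"
      using same_block_rtrancl[OF B] by (metis less_imp_le less_irrefl rtranclD)+
    then have "y \<in> Domain (arcs P) \<inter> Range (arcs P)"
      by (metis DomainI IntI RangeI trancl_domain trancl_range)
    with D show False
      by blast
  qed
  with P show "partial_matching m P"
    by (simp add: partial_matching_def)
qed

section \<open>Splitting and merging vertices\<close>

text \<open>With \<open>D\<close> the set of closers of a partition, each member of \<open>D\<close>
  is doubled: \<open>closer_pos\<close> is the position of its left copy, \<open>opener_pos\<close>
  that of its right copy. Outside \<open>D\<close> the two agree.\<close>

definition opener_pos :: "nat set \<Rightarrow> nat \<Rightarrow> nat" where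
  "opener_pos D v = v + card {d\<in>D. d \<le> v}"

definition closer_pos :: "nat set \<Rightarrow> nat \<Rightarrow> nat" where
  "closer_pos D v = v + card {d\<in>D. d < v}"

text \<open>With \<open>C\<close> the set of closers of a matching, each closer is glued to its
  right neighbor, so every vertex moves left by the number of closers strictly before it.\<close>

definition merge_pos :: "nat set \<Rightarrow> nat \<Rightarrow> nat" where
  "merge_pos C v = v - card {c\<in>C. c < v}"

definition split_closers :: "(nat \<times> nat) set \<Rightarrow> (nat \<times> nat) set" where
  "split_closers B = map_prod (opener_pos (Range B)) (closer_pos (Range B)) ` B"

definition merge_closers :: "(nat \<times> nat) set \<Rightarrow> (nat \<times> nat) set" where
  "merge_closers A = map_prod (merge_pos (Range A)) (merge_pos (Range A)) ` A"

section \<open>Order of the split positions\<close>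

lemma card_le_eq:
  fixes v :: nat
  shows "card {d\<in>D. d \<le> v} = card {d\<in>D. d < v} + (if v \<in> D then 1 else 0)"
proof -
  have "{d\<in>D. d \<le> v} = (if v \<in> D then insert v {d\<in>D. d < v} else {d\<in>D. d < v})"
    by (auto simp: le_less)
  then show ?thesis
    by simp
qed

lemma opener_pos_eq: "opener_pos D v = closer_pos D v + (if v \<in> D then 1 else 0)"
  by (simp add: opener_pos_def closer_pos_def card_le_eq)

text \<open>The copies of consecutive vertices follow each other without a gap.\<close>

lemma closer_pos_Suc: "closer_pos D (Suc v) = Suc (opener_pos D v)"
  by (simp add: opener_pos_def closer_pos_def less_Suc_eq_le)

lemma strict_mono_closer_pos: "strict_mono (closer_pos D)"
  by (simp add: strict_mono_Suc_iff closer_pos_Suc opener_pos_eq)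

lemma inj_on_closer_pos: "inj_on (closer_pos D) S"
  by (rule strict_mono_on_imp_inj_on[OF monotone_on_subset[OF strict_mono_closer_pos]]) simp

lemma closer_pos_less_iff [simp]: "closer_pos D v < closer_pos D w \<longleftrightarrow> v < w"
  by (simp add: strict_mono_closer_pos strict_mono_less)

lemma opener_pos_less_closer_pos_iff:
  assumes "d \<in> D"
  shows "opener_pos D v < closer_pos D d \<longleftrightarrow> v < d"
proof -
  have "closer_pos D (Suc v) \<le> closer_pos D d \<longleftrightarrow> Suc v \<le> d"
    by (simp add: strict_mono_closer_pos strict_mono_less_eq)
  then show ?thesis
    by (simp add: closer_pos_Suc Suc_le_eq)
qed

lemma closer_pos_less_opener_pos_iff:
  assumes "d \<in> D"
  shows "closer_pos D d < opener_pos D v \<longleftrightarrow> d \<le> v"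
proof (cases d v rule: linorder_cases)
  case less
  then have "closer_pos D d < closer_pos D v"
    by simp
  with less show ?thesis
    by (simp add: opener_pos_eq less_Suc_eq)
next
  case greater
  then show ?thesis
    using opener_pos_less_closer_pos_iff[OF assms, of v] by simp
qed (use assms in \<open>simp add: opener_pos_eq\<close>)

lemma strict_mono_opener_pos: "strict_mono (opener_pos D)"
proof -
  have "opener_pos D v < opener_pos D (Suc v)" for v
    by (simp add: opener_pos_eq[of D "Suc v"] closer_pos_Suc)
  then show ?thesis
    by (simp add: strict_mono_Suc_iff)
qed

lemma inj_on_opener_pos: "inj_on (opener_pos D) S"
  by (rule strict_mono_on_imp_inj_on[OF monotone_on_subset[OF strict_mono_opener_pos]]) simp

lemma opener_pos_less_iff [simp]: "opener_pos D v < opener_pos D w \<longleftrightarrow> v < w"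
  by (simp add: strict_mono_opener_pos strict_mono_less)

text \<open>The right copy of \<open>v\<close> separates the two closers. Hence distance at most 2
  after splitting means adjacency before, which matches 2-right crossings with right
  crossings.\<close>

lemma closer_pos_gap:
  assumes "v \<in> D" "w \<in> D" "v < w"
  shows "closer_pos D v + 2 \<le> closer_pos D w" "closer_pos D w \<le> closer_pos D v + 2 \<longleftrightarrow> w = Suc v"
proof -
  have v: "closer_pos D (Suc v) = closer_pos D v + 2"
    using assms by (simp add: closer_pos_Suc opener_pos_eq)
  moreover have "closer_pos D (Suc v) \<le> closer_pos D w"
    using assms by (simp add: strict_mono_closer_pos strict_mono_less_eq)
  ultimately show "closer_pos D v + 2 \<le> closer_pos D w"
    by simp
  show "closer_pos D w \<le> closer_pos D v + 2 \<longleftrightarrow> w = Suc v"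
    unfolding v[symmetric] using assms by (auto simp: strict_mono_closer_pos strict_mono_less_eq)
qed

section \<open>Merging undoes splitting\<close>

text \<open>The closers left of the copy of \<open>v\<close> are the images of the
  \<open>d < v\<close> in \<open>D\<close>, so merging subtracts exactly the shift that splitting
  added.\<close>

lemma merge_pos_closer_pos:
  "merge_pos (closer_pos D ` D) (closer_pos D v) = v"
proof -
  have "{c \<in> closer_pos D ` D. c < closer_pos D v} = closer_pos D ` {d\<in>D. d < v}"
    by auto
  then have "card {c \<in> closer_pos D ` D. c < closer_pos D v} = card {d\<in>D. d < v}"
    by (simp add: card_image inj_on_closer_pos)
  then show ?thesis
    by (simp add: merge_pos_def closer_pos_def)
qed

lemma merge_pos_opener_pos:
  "merge_pos (closer_pos D ` D) (opener_pos D v) = v"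
proof -
  have "{c \<in> closer_pos D ` D. c < opener_pos D v} = closer_pos D ` {d\<in>D. d \<le> v}"
    by (auto simp: closer_pos_less_opener_pos_iff)
  then have "card {c \<in> closer_pos D ` D. c < opener_pos D v} = card {d\<in>D. d \<le> v}"
    by (simp add: card_image inj_on_closer_pos)
  then show ?thesis
    by (simp add: merge_pos_def opener_pos_def)
qed

section \<open>Merging along closers of which no two are adjacent\<close>

text \<open>Guarantees that the subtraction in \<open>merge_pos\<close> does not truncate.\<close>

lemma card_less_le:
  fixes v :: nat
  shows "card {c\<in>C. c < v} \<le> v"
  using card_mono[of "{..<v}" "{c\<in>C. c < v}"] by auto

lemma merge_pos_Suc: "merge_pos C (Suc v) = merge_pos C v + (if v \<in> C then 0 else 1)"
  using card_less_le[of C v] by (simp add: merge_pos_def less_Suc_eq_le card_le_eq)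

lemma mono_merge_pos: "mono (merge_pos C)"
  by (simp add: mono_iff_le_Suc merge_pos_Suc)

lemma merge_pos_less:
  assumes "v < w" "v \<notin> C"
  shows "merge_pos C v < merge_pos C w"
  using monoD[OF mono_merge_pos, of "Suc v" w C] assms by (simp add: merge_pos_Suc)

text \<open>\<open>merge_pos\<close> stalls only in passing from a closer to its successor. If
  \<open>v\<close> is a closer, that successor is not one, so it lies strictly before
  \<open>w\<close> and the next step is strict.\<close>

lemma merge_pos_less_sparse:
  assumes sparse: "\<forall>c\<in>C. Suc c \<notin> C" and "v < w" "w \<in> C"
  shows "merge_pos C v < merge_pos C w"
proof (cases "v \<in> C")
  case True
  with assms have "Suc v \<notin> C" "Suc v < w"
    by (metis Suc_lessI)+
  then show ?thesis
    using merge_pos_less[of "Suc v" w C] True by (simp add: merge_pos_Suc)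
qed (simp add: merge_pos_less assms)

lemma inj_on_merge_pos_sparse:
  assumes sparse: "\<forall>c\<in>C. Suc c \<notin> C"
  shows "inj_on (merge_pos C) C"
  by (rule linorder_inj_onI') (use merge_pos_less_sparse[OF sparse] in fastforce)

lemma merge_pos_less_sparse_iff:
  assumes sparse: "\<forall>c\<in>C. Suc c \<notin> C" and "w \<in> C"
  shows "merge_pos C v < merge_pos C w \<longleftrightarrow> v < w"
  using merge_pos_less_sparse[OF sparse] assms(2) monoD[OF mono_merge_pos, of w v C]
  by (meson leD not_le)

text \<open>On a sparse \<open>C\<close> merging preserves the strict order of closers, so the
  merged closers before the image of \<open>v\<close> are as many as the closers before
  \<open>v\<close>.\<close>

lemma closer_pos_merge_pos:
  assumes sparse: "\<forall>c\<in>C. Suc c \<notin> C" and "v \<in> C"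
  shows "closer_pos (merge_pos C ` C) (merge_pos C v) = v"
proof -
  have "{d \<in> merge_pos C ` C. d < merge_pos C v} = merge_pos C ` {c\<in>C. c < v}"
    using merge_pos_less_sparse_iff[OF sparse \<open>v \<in> C\<close>] by auto
  moreover have "inj_on (merge_pos C) {c\<in>C. c < v}"
    by (rule inj_on_subset[OF inj_on_merge_pos_sparse[OF sparse]]) auto
  ultimately have "card {d \<in> merge_pos C ` C. d < merge_pos C v} = card {c\<in>C. c < v}"
    by (simp add: card_image)
  then show ?thesis
    using card_less_le[of C v] by (simp add: closer_pos_def merge_pos_def)
qed

text \<open>A closer directly before \<open>v\<close> merges with \<open>v\<close>; counting with
  \<open>\<le>\<close>, as \<open>opener_pos\<close> does, includes it.\<close>

lemma opener_pos_merge_pos: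
  assumes sparse: "\<forall>c\<in>C. Suc c \<notin> C" and "v \<notin> C"
  shows "opener_pos (merge_pos C ` C) (merge_pos C v) = v"
proof -
  have "merge_pos C c \<le> merge_pos C v \<longleftrightarrow> c < v" if "c \<in> C" for c
    using merge_pos_less_sparse_iff[OF sparse that, of v] that \<open>v \<notin> C\<close>
    by (metis linorder_neqE_nat not_le not_less_iff_gr_or_eq)
  then have "{d \<in> merge_pos C ` C. d \<le> merge_pos C v} = merge_pos C ` {c\<in>C. c < v}"
    by auto
  moreover have "inj_on (merge_pos C) {c\<in>C. c < v}"
    by (rule inj_on_subset[OF inj_on_merge_pos_sparse[OF sparse]]) auto
  ultimately have "card {d \<in> merge_pos C ` C. d \<le> merge_pos C v} = card {c\<in>C. c < v}"
    by (simp add: card_image)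
  then show ?thesis
    using card_less_le[of C v] by (simp add: opener_pos_def merge_pos_def)
qed

section \<open>The bijection on arc diagrams\<close>

text \<open>Disjointness of openers and closers expresses that blocks have at most two elements, by
  \<open>partial_matching_iff_arcs\<close>.\<close>

definition matching_diagrams :: "nat \<Rightarrow> nat \<Rightarrow> (nat \<times> nat) set set" where
  "matching_diagrams m k = {A. arc_diagram m A \<and> Domain A \<inter> Range A = {} \<and> card A = k \<and>
     (\<forall>a\<in>A. \<forall>b\<in>A. \<not> two_right_crossing a b \<and> \<not> right_nesting a b)}"

definition CT_diagrams :: "nat \<Rightarrow> nat \<Rightarrow> (nat \<times> nat) set set" where
  "CT_diagrams n k = {B. arc_diagram n B \<and> card B = k \<and> (\<forall>a\<in>B. \<forall>b\<in>B. \<not> right_crossing a b)}"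

lemma Range_map_prod: "Range (map_prod f g ` A) = g ` Range A"
  by force

lemma Range_split_closers: "Range (split_closers B) = closer_pos (Range B) ` Range B"
  by (simp add: split_closers_def Range_map_prod)

lemma Range_merge_closers: "Range (merge_closers A) = merge_pos (Range A) ` Range A"
  by (simp add: merge_closers_def Range_map_prod)

lemma merge_split_closers: "merge_closers (split_closers B) = B"
  unfolding merge_closers_def Range_split_closers
  by (simp add: split_closers_def image_image map_prod_def case_prod_beta
      merge_pos_closer_pos merge_pos_opener_pos)

text \<open>Two arcs with adjacent closers either cross, giving a 2-right crossing, or nest, giving
  a right nesting.\<close>

lemma matching_diagram_sparse:
  assumes A: "A \<in> matching_diagrams m k"
  shows "\<forall>c\<in>Range A. Suc c \<notin> Range A"
proof (intro ballI notI)
  fix c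
  assume "c \<in> Range A" "Suc c \<in> Range A"
  then obtain i i' where arcs: "(i, c) \<in> A" "(i', Suc c) \<in> A"
    by blast
  have diag: "arc_diagram m A" and disj: "Domain A \<inter> Range A = {}"
    using A by (auto simp: matching_diagrams_def)
  have "i \<noteq> i'"
    using arcs arc_diagram_same_opener[OF diag, of i c "Suc c"] by auto
  moreover have "i < c"
    using arcs(1) arc_diagramD(2)[OF diag] by blast
  \<comment> \<open>\<open>i' = c\<close> is impossible, since \<open>c\<close> would be both an
    opener and a closer.\<close>
  moreover have "i' < c"
    using arcs arc_diagramD(2)[OF diag arcs(2)] disj by (auto simp: less_Suc_eq)
  ultimately have "two_right_crossing (i, c) (i', Suc c) \<or> right_nesting (i', Suc c) (i, c)"
    by (auto simp: two_right_crossing_def right_nesting_def)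
  with A arcs show False
    by (auto simp: matching_diagrams_def)
qed

lemma split_merge_closers:
  assumes A: "A \<in> matching_diagrams m k"
  shows "split_closers (merge_closers A) = A"
proof -
  note sparse = matching_diagram_sparse[OF A]
  have "map_prod (opener_pos (merge_pos (Range A) ` Range A)) (closer_pos (merge_pos (Range A) ` Range A))
      (map_prod (merge_pos (Range A)) (merge_pos (Range A)) a) = a" if "a \<in> A" for a
  proof -
    have "fst a \<notin> Range A" "snd a \<in> Range A"
      using A that by (cases a; auto simp: matching_diagrams_def)+
    then show ?thesis
      by (cases a) (simp add: opener_pos_merge_pos[OF sparse] closer_pos_merge_pos[OF sparse])
  qed
  then show ?thesis
    unfolding split_closers_def Range_merge_closers
    by (simp add: merge_closers_def image_image)
qed

lemma split_closers_matching_diagram: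
  assumes B: "B \<in> CT_diagrams n k"
  shows "split_closers B \<in> matching_diagrams (n + k - 1) k"
proof -
  define D where "D = Range B"
  have diag: "arc_diagram n B" and cardB: "card B = k"
    and nocross: "\<And>a b. a \<in> B \<Longrightarrow> b \<in> B \<Longrightarrow> \<not> right_crossing a b"
    using B by (auto simp: CT_diagrams_def)
  have finD: "finite D" and cardD: "card D = k"
    using arc_diagram_finite[OF diag] arc_diagram_card_Range[OF diag] cardB
    by (auto simp: D_def finite_Range)
  have split: "split_closers B = map_prod (opener_pos D) (closer_pos D) ` B"
    by (simp add: split_closers_def D_def)
  have inj: "inj (opener_pos D)" "inj (closer_pos D)"
    by (simp_all add: inj_on_opener_pos inj_on_closer_pos)
  have bound: "1 \<le> opener_pos D i \<and> opener_pos D i < closer_pos D j \<and> closer_pos D j \<le> n + k - 1"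
    if "(i, j) \<in> B" for i j
  proof -
    have j: "j \<in> D"
      using that by (auto simp: D_def)
    \<comment> \<open>The closer \<open>j\<close> does not count itself, so it is shifted by at most
      \<open>k - 1\<close>. This gives the bound \<open>n + k - 1\<close> instead of
      \<open>n + k\<close>.\<close>
    have "card {d\<in>D. d < j} < card D"
      using finD j by (intro psubset_card_mono) auto
    then show ?thesis
      using arc_diagramD[OF diag that] j cardD
      by (auto simp: opener_pos_less_closer_pos_iff) (auto simp: opener_pos_def closer_pos_def)
  qed
  have "arc_diagram (n + k - 1) (split_closers B)"
    unfolding arc_diagram_def
  proof (intro conjI)
    show "\<forall>(i, j)\<in>split_closers B. 1 \<le> i \<and> i < j \<and> j \<le> n + k - 1"
      using bound by (auto simp: split)
    show "single_valued (split_closers B)"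
      using inj arc_diagram_same_opener[OF diag]
      by (auto simp: split single_valued_def dest!: injD)
    show "single_valued ((split_closers B)\<inverse>)"
      using inj arc_diagram_same_closer[OF diag]
      by (auto simp: split single_valued_def dest!: injD)
  qed
  \<comment> \<open>If the positions were equal, both comparisons with the closer copy would fail,
    although one of \<open>i < j\<close> and \<open>j \<le> i\<close> holds.\<close>
  moreover have "opener_pos D i \<noteq> closer_pos D j" if "j \<in> D" for i j
    using opener_pos_less_closer_pos_iff[OF that, of i] closer_pos_less_opener_pos_iff[OF that, of i]
    by (metis less_irrefl not_le)
  then have "Domain (split_closers B) \<inter> Range (split_closers B) = {}"
    by (force simp: split D_def)
  moreover have "card (split_closers B) = k"
    unfolding split cardB[symmetric] by (intro card_image inj_on_subset[OF prod.inj_map[OF inj]]) auto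
  moreover have "\<not> two_right_crossing a b \<and> \<not> right_nesting a b"
    if ab: "a \<in> split_closers B" "b \<in> split_closers B" for a b
  proof -
    obtain i1 j1 i2 j2 where ab_eq: "a = (opener_pos D i1, closer_pos D j1)"
      "b = (opener_pos D i2, closer_pos D j2)" and arcs: "(i1, j1) \<in> B" "(i2, j2) \<in> B"
      using ab by (auto simp: split)
    then have j: "j1 \<in> D" "j2 \<in> D"
      by (auto simp: D_def)
    have "\<not> two_right_crossing a b"
    proof
      assume "two_right_crossing a b"
      then have "i1 < i2" "i2 < j1" "j1 < j2" "closer_pos D j2 \<le> closer_pos D j1 + 2"
        using j by (auto simp: two_right_crossing_def ab_eq opener_pos_less_closer_pos_iff)
      then have "right_crossing (i1, j1) (i2, j2)"
        using closer_pos_gap(2)[OF j] by (simp add: right_crossing_def)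
      with nocross arcs show False
        by blast
    qed
    moreover have "\<not> right_nesting a b"
    proof
      assume "right_nesting a b"
      then have "j2 < j1" "closer_pos D j1 = closer_pos D j2 + 1"
        by (auto simp: right_nesting_def ab_eq)
      with closer_pos_gap(1)[OF j(2,1)] show False
        by simp
    qed
    ultimately show ?thesis ..
  qed
  ultimately show ?thesis
    by (auto simp: matching_diagrams_def)
qed

lemma merge_closers_CT_diagram:
  assumes n: "n \<ge> 1" and A: "A \<in> matching_diagrams (n + k - 1) k"
  shows "merge_closers A \<in> CT_diagrams n k"
proof -
  define C where "C = Range A"
  have diag: "arc_diagram (n + k - 1) A" and cardA: "card A = k"
    and nocross: "\<And>a b. a \<in> A \<Longrightarrow> b \<in> A \<Longrightarrow> \<not> two_right_crossing a b"
    and disj: "Domain A \<inter> C = {}"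
    using A by (auto simp: matching_diagrams_def C_def)
  have sparse: "\<forall>c\<in>C. Suc c \<notin> C"
    using matching_diagram_sparse[OF A] by (simp add: C_def)
  have finC: "finite C" and cardC: "card C = k"
    using arc_diagram_finite[OF diag] arc_diagram_card_Range[OF diag] cardA
    by (auto simp: C_def finite_Range)
  have merge: "merge_closers A = map_prod (merge_pos C) (merge_pos C) ` A"
    by (simp add: merge_closers_def C_def)
  have opener: "i \<notin> C" and closer: "j \<in> C" if "(i, j) \<in> A" for i j
    using that disj by (auto simp: C_def)
  note inv = opener_pos_merge_pos[OF sparse opener] closer_pos_merge_pos[OF sparse closer]
  have pos: "1 \<le> merge_pos C i" if "1 \<le> i" for i
  proof -
    have "0 \<notin> C"
      using arc_diagramD(2)[OF diag] by (auto simp: C_def)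
    then have "merge_pos C (Suc 0) = 1"
      by (simp add: merge_pos_Suc) (simp add: merge_pos_def)
    then show ?thesis
      using monoD[OF mono_merge_pos that, of C] by simp
  qed
  have le_n: "merge_pos C j \<le> n" if "j \<le> n + k - 1" for j
  proof -
    \<comment> \<open>At most one closer, the last vertex itself, is not strictly before the last
      vertex. So at least \<open>k - 1\<close> closers are subtracted there.\<close>
    have "C \<subseteq> insert (n + k - 1) {c\<in>C. c < n + k - 1}"
      using arc_diagramD(3)[OF diag] by (force simp: C_def)
    then have "k \<le> Suc (card {c\<in>C. c < n + k - 1})"
      using card_mono[of "insert (n + k - 1) {c\<in>C. c < n + k - 1}" C] finC cardC by simp
    then have "merge_pos C (n + k - 1) \<le> n"
      using n by (auto simp: merge_pos_def)
    then show ?thesis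
      using monoD[OF mono_merge_pos that, of C] by simp
  qed
  \<comment> \<open>Merging is injective on openers and on closers separately; a closer and the
    opener right after it do coincide.\<close>
  have same: "merge_pos C i1 = merge_pos C i2 \<longleftrightarrow> i1 = i2" "merge_pos C j1 = merge_pos C j2 \<longleftrightarrow> j1 = j2"
    if "(i1, j1) \<in> A" "(i2, j2) \<in> A" for i1 j1 i2 j2
    using that inv by metis+
  have "arc_diagram n (merge_closers A)"
    unfolding arc_diagram_def
  proof (intro conjI)
    show "\<forall>(i, j)\<in>merge_closers A. 1 \<le> i \<and> i < j \<and> j \<le> n"
      using arc_diagramD[OF diag] pos le_n by (auto simp: merge intro!: merge_pos_less[OF _ opener])
    show "single_valued (merge_closers A)"
      using same arc_diagram_same_opener[OF diag] by (auto simp: merge single_valued_def)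
    show "single_valued ((merge_closers A)\<inverse>)"
      using same arc_diagram_same_closer[OF diag] by (auto simp: merge single_valued_def)
  qed
  moreover have "card (merge_closers A) = k"
    unfolding merge cardA[symmetric]
    by (intro card_image) (use same in \<open>auto simp: inj_on_def\<close>)
  moreover have "\<not> right_crossing a b" if ab: "a \<in> merge_closers A" "b \<in> merge_closers A" for a b
  proof
    assume cross: "right_crossing a b"
    obtain i1 j1 i2 j2 where ab_eq: "a = (merge_pos C i1, merge_pos C j1)"
      "b = (merge_pos C i2, merge_pos C j2)" and arcs: "(i1, j1) \<in> A" "(i2, j2) \<in> A"
      using ab by (auto simp: merge)
    have less: "v < w" if "merge_pos C v < merge_pos C w" for v w
      using monoD[OF mono_merge_pos, of w v C] that by (meson leD not_le)
    have "i1 < i2" "i2 < j1" "j1 < j2" and succ: "merge_pos C j2 = Suc (merge_pos C j1)"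
      using cross less by (auto simp: right_crossing_def ab_eq)
    \<comment> \<open>\<open>closer_pos\<close> recovers \<open>j1\<close> and \<open>j2\<close>
      from their merged positions, and it grows by at most 2 from one vertex to the next.\<close>
    moreover have "j2 \<le> j1 + 2"
      using inv(2)[OF arcs(1)] inv(2)[OF arcs(2)] unfolding succ closer_pos_Suc opener_pos_eq
      by (simp split: if_splits)
    ultimately have "two_right_crossing (i1, j1) (i2, j2)"
      by (simp add: two_right_crossing_def)
    with nocross arcs show False
      by blast
  qed
  ultimately show ?thesis
    by (auto simp: CT_diagrams_def)
qed

lemma bij_betw_split_closers:
  assumes "n \<ge> 1"
  shows "bij_betw split_closers (CT_diagrams n k) (matching_diagrams (n + k - 1) k)"
proof (rule bij_betw_byWitness[where f' = merge_closers])
  show "split_closers ` CT_diagrams n k \<subseteq> matching_diagrams (n + k - 1) k"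
    using split_closers_matching_diagram by blast
  show "merge_closers ` matching_diagrams (n + k - 1) k \<subseteq> CT_diagrams n k"
    using merge_closers_CT_diagram[OF assms] by blast
qed (auto simp: merge_split_closers split_merge_closers)

section \<open>Neighbor alignments and transients\<close>

text \<open>An opener directly after the closer copy of \<open>j\<close> must be the right copy of
  the same \<open>j\<close>, so \<open>j\<close> closes one arc and opens another in
  \<open>Q\<close>.\<close>

lemma card_neighbor_alignments_split:
  assumes P: "partition_on {1..m} P" and Q: "partition_on {1..n} Q"
    and split: "arcs P = split_closers (arcs Q)"
  shows "card (neighbor_alignments P) = card (transients Q)"
proof -
  define D where "D = Range (arcs Q)"
  have arcsP: "arcs P = map_prod (opener_pos D) (closer_pos D) ` arcs Q"
    by (simp add: split split_closers_def D_def)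
  note diagP = arc_diagram_arcs[OF P] and diagQ = arc_diagram_arcs[OF Q]
  have adjacent: "opener_pos D i = closer_pos D j + 1 \<longleftrightarrow> i = j" if "j \<in> D" for i j
    using that closer_pos_less_opener_pos_iff[OF that, of i] opener_pos_less_iff[of D j i]
    by (auto simp: opener_pos_eq[of D j] le_less)
  \<comment> \<open>The closer of the first arc determines that arc, and its successor is the opener
    that determines the second.\<close>
  have "inj_on (\<lambda>(a, b). snd a) (neighbor_alignments P)"
    using arc_diagram_same_opener[OF diagP] arc_diagram_same_closer[OF diagP]
    by (auto simp: inj_on_def neighbor_alignments_def neighbor_alignment_def)
  then have "card (neighbor_alignments P) = card ((\<lambda>(a, b). snd a) ` neighbor_alignments P)"
    by (simp add: card_image)
  also have "(\<lambda>(a, b). snd a) ` neighbor_alignments P = closer_pos D ` transients Q"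
  proof (intro equalityI subsetI)
    fix v
    assume "v \<in> (\<lambda>(a, b). snd a) ` neighbor_alignments P"
    then obtain i j i' j' where "(i, j) \<in> arcs Q" "(i', j') \<in> arcs Q" "v = closer_pos D j"
      "opener_pos D i' = closer_pos D j + 1"
      by (auto simp: neighbor_alignments_def neighbor_alignment_def arcsP)
    moreover from this have "i' = j"
      using adjacent[of j i'] by (auto simp: D_def)
    ultimately have "j \<in> transients Q"
      using arc_diagramD(2)[OF diagQ] unfolding transients_def by blast
    with \<open>v = closer_pos D j\<close> show "v \<in> closer_pos D ` transients Q"
      by blast
  next
    fix v
    assume "v \<in> closer_pos D ` transients Q"
    then obtain i j l where arcs: "(i, j) \<in> arcs Q" "(j, l) \<in> arcs Q" and v: "v = closer_pos D j"
      by (auto simp: transients_def)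
    have "opener_pos D j = closer_pos D j + 1"
      using adjacent[of j j] arcs by (auto simp: D_def)
    with arcs have "((opener_pos D i, closer_pos D j), (opener_pos D j, closer_pos D l)) \<in> neighbor_alignments P"
      by (force simp: neighbor_alignments_def neighbor_alignment_def arcsP)
    then show "v \<in> (\<lambda>(a, b). snd a) ` neighbor_alignments P"
      unfolding v by force
  qed
  also have "card \<dots> = card (transients Q)"
    by (intro card_image inj_on_closer_pos)
  finally show ?thesis .
qed

section \<open>Transfer from arc diagrams to set partitions\<close>

lemma bij_betw_vimage_restrict:
  assumes "bij_betw f A B" "C \<subseteq> B"
  shows "bij_betw f {x\<in>A. f x \<in> C} C"
  using assms by (auto simp: bij_betw_def inj_on_def)

lemma bij_betw_arcs_matchings:
  "bij_betw arcs (matchings_P m k) (matching_diagrams m k)"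
proof -
  have "M \<in> matchings_P m k \<longleftrightarrow> partition_on {1..m} M \<and> arcs M \<in> matching_diagrams m k" for M
  proof (cases "partition_on {1..m} M")
    case True
    then show ?thesis
      unfolding matchings_P_def matching_diagrams_def
      by (simp add: partial_matching_iff_arcs[OF True] arc_diagram_arcs[OF True] del: One_nat_def)
  qed (auto simp: matchings_P_def partial_matching_def)
  then have "matchings_P m k = {P \<in> {P. partition_on {1..m} P}. arcs P \<in> matching_diagrams m k}"
    by blast
  moreover have "matching_diagrams m k \<subseteq> {A. arc_diagram m A}"
    by (auto simp: matching_diagrams_def)
  ultimately show ?thesis
    using bij_betw_vimage_restrict[OF bij_betw_arcs] by metis
qed

lemma bij_betw_arcs_CT:
  "bij_betw arcs (partitions_CT n k) (CT_diagrams n k)"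
proof -
  have "partitions_CT n k = {P \<in> {P. partition_on {1..n} P}. arcs P \<in> CT_diagrams n k}"
    using arc_diagram_arcs by (auto simp: partitions_CT_def CT_diagrams_def)
  moreover have "CT_diagrams n k \<subseteq> {A. arc_diagram n A}"
    by (auto simp: CT_diagrams_def)
  ultimately show ?thesis
    using bij_betw_vimage_restrict[OF bij_betw_arcs] by metis
qed

theorem theorem3p1:
  fixes n k :: nat
  assumes "n \<ge> 1" and "k \<le> n - 1"
  shows "\<exists>f. bij_betw f (matchings_P (n + k - 1) k) (partitions_CT n k) \<and>
           (\<forall>M \<in> matchings_P (n + k - 1) k.
              card (neighbor_alignments M) = card (transients (f M)))"
proof -
  let ?P = "matchings_P (n + k - 1) k" and ?CT = "partitions_CT n k"
  \<comment> \<open>Splitting is defined on partitions, so \<open>g\<close> runs from partitions to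
    matchings: take arcs, split, and read the result as a matching. The required bijection is the
    inverse of \<open>g\<close>.\<close>
  define g where "g = inv_into ?P arcs \<circ> (split_closers \<circ> arcs)"
  have split: "bij_betw (split_closers \<circ> arcs) ?CT (matching_diagrams (n + k - 1) k)"
    using bij_betw_trans[OF bij_betw_arcs_CT bij_betw_split_closers[OF \<open>n \<ge> 1\<close>]] .
  then have g: "bij_betw g ?CT ?P"
    unfolding g_def by (intro bij_betw_trans[OF _ bij_betw_inv_into[OF bij_betw_arcs_matchings]])
  have arcs_g: "arcs (g Q) = split_closers (arcs Q)" if "Q \<in> ?CT" for Q
    using bij_betwE[OF split] that bij_betw_inv_into_right[OF bij_betw_arcs_matchings]
    by (simp add: g_def)
  have "card (neighbor_alignments M) = card (transients (inv_into ?CT g M))" if M: "M \<in> ?P" for M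
  proof (rule card_neighbor_alignments_split)
    have Q: "inv_into ?CT g M \<in> ?CT"
      using bij_betwE[OF bij_betw_inv_into[OF g]] M by blast
    then show "partition_on {1..n} (inv_into ?CT g M)"
      by (simp add: partitions_CT_def)
    show "partition_on {1..n + k - 1} M"
      using M by (simp add: matchings_P_def partial_matching_def)
    show "arcs M = split_closers (arcs (inv_into ?CT g M))"
      using arcs_g[OF Q] bij_betw_inv_into_right[OF g M] by simp
  qed
  with bij_betw_inv_into[OF g] show ?thesis
    by blast
qed

end
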